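(* Let $d\ge 2$, let $p$ be a prime with $d\mid(p-1)$, and let $q$ be a power of $p$. Then $MD_d(\lambda,\mathbb{F}_q)\le\sqrt{2(q-1)/d}+4$ for every $\lambda\in\mathbb{F}_q^*$.
   Context: $S_d=\{x^d:x\in\mathbb{F}_q^*\}$. A set of distinct elements $a_1,\dots,a_m$ of $\mathbb{F}_q^*$ has property $D_d(\lambda,\mathbb{F}_q)$ if $a_ia_j+\lambda\in S_d\cup\{0\}$ whenever $i\ne j$; $MD_d(\lambda,\mathbb{F}_q)$ is the maximum size of a subset of $\mathbb{F}_q^*$ with this property. *)

theory Defs
  imports Complex_Main "HOL-Computational_Algebra.Primes" "HOL-Library.Cardinality"
begin

text \<open>The finite field with \<open>q\<close> elements is rendered as a type \<open>'a\<close> of class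
  \<open>{field, finite}\<close> with \<open>CARD('a) = q\<close>.\<close>

definition nonzero_powers :: "nat \<Rightarrow> 'a::field set" where
  "nonzero_powers d = {x ^ d | x. x \<noteq> 0}"

definition has_property_D :: "nat \<Rightarrow> 'a::field \<Rightarrow> 'a set \<Rightarrow> bool" where
  "has_property_D d c A \<longleftrightarrow>
     (\<forall>a\<in>A. \<forall>b\<in>A. a \<noteq> b \<longrightarrow> a * b + c \<in> nonzero_powers d \<union> {0})"

definition MD :: "nat \<Rightarrow> 'a::{field,finite} \<Rightarrow> nat" where
  "MD d c = Max {card A | A. A \<subseteq> UNIV - {0} \<and> has_property_D d c A}"

end

theory Submission
  imports Defs "HOL-Number_Theory.Residues" "HOL-Computational_Algebra.Polynomial"
begin

text \<open>
  Stepanov's method. Let \<open>k = (q - 1) / d\<close> and let \<open>A\<close> have \<open>m\<close> elements and property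
  \<open>D\<close>. Consider
    \<open>f = (\<Sum>a\<in>A. \<gamma> a * (x - a)^r * (a * x + c)^(k + s))\<close>,
  with weights \<open>\<gamma>\<close> annihilating all polynomials in \<open>a\<close> of degree at most \<open>r + s\<close>. At
  \<open>b \<in> A\<close> the term \<open>a = b\<close> vanishes to order \<open>r\<close>, and in the Taylor coefficients of the others
  of order below \<open>r\<close> the factor \<open>(a * b + c)^k\<close> can be dropped, which leaves a polynomial of
  degree at most \<open>r + s\<close> in \<open>a\<close>. So \<open>f\<close> vanishes to order \<open>r\<close> on \<open>A\<close>, and \<open>f \<noteq> 0\<close>
  yields \<open>r * m \<le> r + k - 1\<close> with \<open>r\<close> about \<open>m / 2\<close>.

  Whether \<open>f \<noteq> 0\<close> depends on binomial coefficients modulo \<open>p\<close>. If the base-\<open>p\<close> addition of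
  \<open>R = m div 2 - 1\<close> and \<open>k - 1\<close> has no carry, \<open>s = R - 1\<close> works. Otherwise let \<open>j\<close> be the
  position above the topmost carry and choose \<open>s\<close> so that \<open>k + s\<close> is a multiple of \<open>p ^ j\<close>:
  most Taylor coefficients of \<open>(a * x + c)^(k + s)\<close> then disappear. All base-\<open>p\<close> digits of
  \<open>k\<close> are \<open>(p - 1) / d\<close>, less than \<open>p / 2\<close>, and this provides a nonzero coefficient of \<open>f\<close>.
\<close>

subsection \<open>Binomial coefficients modulo a prime\<close>

lemma prime_dvd_prime_power_choose:
  fixes p :: nat
  assumes "prime p" "0 < i" "i < p ^ j"
  shows "p dvd (p ^ j choose i)"
proof (rule ccontr)
  assume "\<not> p dvd (p ^ j choose i)"
  hence "coprime (p ^ j) (p ^ j choose i)"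
    using assms(1) by (simp add: prime_imp_coprime)
  moreover have "p ^ j dvd i * (p ^ j choose i)"
    using assms by (simp add: times_binomial_minus1_eq)
  ultimately have "p ^ j dvd i"
    by (simp add: coprime_dvd_mult_left_iff)
  thus False using assms by (simp add: nat_dvd_not_less)
qed

text \<open>Coefficient form of \<open>(1 + x)^(P + N) = (1 + x^P) * (1 + x)^N\<close> modulo
  \<open>p\<close>.\<close>

lemma choose_add_prime_power_cong:
  fixes p :: nat
  assumes "prime p" and P: "P = p ^ j"
  shows "[(P + N) choose M = (N choose M) + (if P \<le> M then N choose (M - P) else 0)] (mod p)"
proof -
  have P0: "P > 0" using assms by (simp add: prime_gt_0_nat)
  have "(P + N) choose M = (\<Sum>i\<le>M. (P choose i) * (N choose (M - i)))"
    by (rule vandermonde[symmetric])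
  also have "[\<dots> = (\<Sum>i\<le>M. (if i = 0 then N choose M else 0) +
      (if i = P then N choose (M - P) else 0))] (mod p)"
  proof (rule cong_sum)
    fix i
    consider "i = 0" | "0 < i" "i < P" | "i = P" | "i > P" by linarith
    thus "[(P choose i) * (N choose (M - i)) = (if i = 0 then N choose M else 0) +
      (if i = P then N choose (M - P) else 0)] (mod p)"
    proof cases
      case 2
      hence "p dvd (P choose i)" using prime_dvd_prime_power_choose assms by blast
      thus ?thesis using 2 by (simp add: cong_0_iff)
    qed (use P0 in \<open>auto simp: binomial_eq_0\<close>)
  qed
  also have "(\<Sum>i\<le>M. (if i = 0 then N choose M else 0) +
      (if i = P then N choose (M - P) else 0)) =
      (N choose M) + (if P \<le> M then N choose (M - P) else 0)"
    by (simp add: sum.distrib)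
  finally show ?thesis .
qed

text \<open>Lucas's theorem, split at position \<open>j\<close>. Raising \<open>a\<close> by one
  adds \<open>P\<close>, and the previous congruence becomes Pascal's rule for
  \<open>a choose c\<close>.\<close>

theorem lucas_choose_cong:
  fixes p :: nat
  assumes "prime p" "b < p ^ j" "d < p ^ j"
  shows "[(p ^ j * a + b) choose (p ^ j * c + d) = (a choose c) * (b choose d)] (mod p)"
proof (induction a arbitrary: c)
  case 0
  show ?case
  proof (cases c)
    case (Suc c')
    have "b choose (p ^ j * c + d) = 0"
      using Suc assms by (intro binomial_eq_0) simp
    moreover have "0 choose c = 0" using Suc by simp
    ultimately show ?thesis by (simp only: mult_0_right add_0 mult_0 cong_refl)
  qed simp
next
  case (Suc a)
  define P where "P = p ^ j"
  have "[(P + (P * a + b)) choose (P * c + d) = ((P * a + b) choose (P * c + d)) +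
      (if P \<le> P * c + d then (P * a + b) choose (P * c + d - P) else 0)] (mod p)"
    by (rule choose_add_prime_power_cong[OF assms(1) P_def])
  also have "[((P * a + b) choose (P * c + d)) +
      (if P \<le> P * c + d then (P * a + b) choose (P * c + d - P) else 0) =
      (Suc a choose c) * (b choose d)] (mod p)"
  proof (cases c)
    case 0
    thus ?thesis using assms(3) Suc.IH[of 0] by (simp add: P_def)
  next
    case (Suc c')
    have "P * c + d - P = P * c' + d" "P \<le> P * c + d" using Suc by simp_all
    moreover have "[((P * a + b) choose (P * c + d)) + ((P * a + b) choose (P * c' + d)) =
        (a choose c) * (b choose d) + (a choose c') * (b choose d)] (mod p)"
      unfolding P_def by (intro cong_add Suc.IH)
    ultimately show ?thesis using Suc by (simp add: algebra_simps)
  qed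
  finally show ?case by (simp add: P_def algebra_simps)
qed

corollary lucas_choose_dvd_iff:
  fixes p :: nat
  assumes "prime p" "b < p ^ j" "d < p ^ j"
  shows "p dvd (p ^ j * a + b) choose (p ^ j * c + d) \<longleftrightarrow> p dvd a choose c \<or> p dvd b choose d"
  using cong_dvd_iff[OF lucas_choose_cong[OF assms, of a c]] prime_dvd_mult_iff[OF assms(1)] by metis

section \<open>Carries and repeated digits in base \<open>p\<close>\<close>

lemma prime_not_dvd_choose_less:
  fixes p :: nat
  assumes "prime p" "n < p" "k \<le> n"
  shows "\<not> p dvd n choose k"
proof
  assume "p dvd n choose k"
  hence "p dvd fact n"
    using binomial_fact_lemma[OF assms(3)] by (metis dvd_mult)
  thus False using assms by (simp add: prime_dvd_fact_iff)
qed

text \<open>The position \<open>j\<close> is the one just above the topmost carry in the base-\<open>p\<close> addition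
  \<open>R + K\<close>.\<close>

lemma topmost_carry:
  fixes p :: nat
  assumes "prime p" "p dvd (R + K) choose R"
  shows "\<exists>j\<ge>1. p ^ j \<le> R mod p ^ j + K mod p ^ j \<and>
    \<not> p dvd (R div p ^ j + 1 + K div p ^ j) choose (R div p ^ j + 1)"
  using assms(2)
proof (induction K arbitrary: R rule: less_induct)
  case (less K)
  note p = assms(1)
  have p1: "p > 1" using p by (rule prime_gt_1_nat)
  have "K \<noteq> 0"
  proof
    assume "K = 0"
    with less.prems p1 show False by simp
  qed
  hence K': "K div p < K" using p1 by simp
  define R' r K' e where "R' = R div p" and "r = R mod p" and "K' = K div p" and "e = K mod p"
  have R: "R = p * R' + r" and K: "K = p * K' + e" and r: "r < p" and e: "e < p"
    using p1 by (simp_all add: R'_def r_def K'_def e_def)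
  have up: "R mod p ^ Suc i = p * (R' mod p ^ i) + r" "K mod p ^ Suc i = p * (K' mod p ^ i) + e"
    "R div p ^ Suc i = R' div p ^ i" "K div p ^ Suc i = K' div p ^ i" for i
    unfolding R'_def r_def K'_def e_def by (simp_all add: mod_mult2_eq div_mult2_eq)
  show ?case
  proof (cases "r + e < p")
    case True
    have "R + K = p ^ 1 * (R' + K') + (r + e)" by (simp add: R K algebra_simps)
    hence "p dvd (R' + K') choose R' \<or> p dvd (r + e) choose r"
      using less.prems lucas_choose_dvd_iff[OF p, of "r + e" 1 r "R' + K'" R'] True r
      by (metis R power_one_right)
    hence "p dvd (R' + K') choose R'"
      using prime_not_dvd_choose_less[OF p True, of r] by auto
    from less.IH[OF K'[folded K'_def] this] obtain i where i:
      "p ^ i \<le> R' mod p ^ i + K' mod p ^ i"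
      "\<not> p dvd (R' div p ^ i + 1 + K' div p ^ i) choose (R' div p ^ i + 1)" by blast
    have "p * p ^ i \<le> p * (R' mod p ^ i + K' mod p ^ i)" using i(1) by (rule mult_le_mono2)
    hence "p ^ Suc i \<le> R mod p ^ Suc i + K mod p ^ Suc i"
      unfolding up by (simp add: algebra_simps)
    thus ?thesis using i(2) by (intro exI[of _ "Suc i"]) (simp add: up del: power_Suc)
  next
    case False
    show ?thesis
    proof (cases "p dvd (R' + 1 + K') choose (R' + 1)")
      \<comment> \<open>The carry out of the lowest digit is absorbed by passing to
        \<open>R' + 1\<close>.\<close>
      case carry: True
      from less.IH[OF K'[folded K'_def] this] obtain i where i:
        "p ^ i \<le> (R' + 1) mod p ^ i + K' mod p ^ i"
        "\<not> p dvd ((R' + 1) div p ^ i + 1 + K' div p ^ i) choose ((R' + 1) div p ^ i + 1)"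
        by blast
      \<comment> \<open>If \<open>(R' + 1) mod p ^ i\<close> were 0, position \<open>i\<close> would
        receive no carry; so adding 1 leaves the digits from \<open>i\<close> on unchanged.\<close>
      have "K' mod p ^ i < p ^ i" using p1 by simp
      hence "(R' + 1) mod p ^ i \<noteq> 0" using i(1) by linarith
      hence 1: "(R' + 1) mod p ^ i = R' mod p ^ i + 1" "(R' + 1) div p ^ i = R' div p ^ i"
        by (simp_all add: mod_Suc div_Suc split: if_splits)
      have "p * p ^ i \<le> p * (R' mod p ^ i + 1 + K' mod p ^ i)"
        using i(1) unfolding 1 by (rule mult_le_mono2)
      hence "p ^ Suc i \<le> R mod p ^ Suc i + K mod p ^ Suc i"
        unfolding up using False by (simp add: algebra_simps)
      thus ?thesis using i(2) unfolding 1
        by (intro exI[of _ "Suc i"]) (simp add: up del: power_Suc)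
    next
      case no_carry: False
      thus ?thesis using False by (intro exI[of _ 1]) (simp add: R'_def K'_def r_def e_def)
    qed
  qed
qed

lemma repdigit_less:
  fixes p e :: nat
  assumes "e < p"
  shows "(\<Sum>i<j. e * p ^ i) < p ^ j"
proof (induction j)
  case (Suc j)
  have "(e + 1) * p ^ j \<le> p * p ^ j" using assms by (intro mult_le_mono1) simp
  thus ?case using Suc by simp
qed simp

text \<open>\<open>t\<close> is found from the leading digit \<open>a\<close> of \<open>R\<close> down: either \<open>a + e \<ge> p\<close>, and \<open>p - a\<close>
  followed by zeros works, or \<open>a = p - 1 - e\<close>, and \<open>t\<close> has leading digit \<open>e\<close>. The condition
  \<open>2 * e < p\<close> keeps the leading digit of \<open>t\<close> at most \<open>a\<close>.\<close>

lemma repdigit_complement_choose: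
  fixes p e :: nat
  assumes "prime p" "2 * e < p" "R < p ^ j" "p ^ j < R + (\<Sum>i<j. e * p ^ i)"
  shows "\<exists>t<\<Sum>i<j. e * p ^ i. p ^ j \<le> R + t \<and> \<not> p dvd R choose t"
  using assms(3,4)
proof (induction j arbitrary: R)
  case 0
  thus ?case by simp
next
  case (Suc j)
  note p = assms(1)
  define P K where "P = p ^ j" and "K = (\<Sum>i<j. e * p ^ i)"
  define a b where "a = R div P" and "b = R mod P"
  have P0: "P > 0" using p by (simp add: P_def prime_gt_0_nat)
  have R: "R = P * a + b" and b: "b < P" using P0 by (simp_all add: a_def b_def)
  have a: "a < p" using Suc.prems(1) by (simp add: a_def P_def less_mult_imp_div_less)
  have big: "p * P < P * a + b + (K + e * P)" using Suc.prems(2) by (simp add: R K_def P_def)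
  have goal: "(\<Sum>i<Suc j. e * p ^ i) = K + e * P" by (simp add: K_def P_def)
  show ?case
  proof (cases "p \<le> a + e")
    case True
    define t where "t = P * (p - a) + 0"
    have "t < K + e * P"
    proof (cases "p - a < e")
      case True
      hence "P * (p - a) < P * e" using P0 by simp
      thus ?thesis unfolding t_def by (simp only: mult.commute[of e P])
    next
      case False
      hence pa: "p - a = e" using True by simp
      \<comment> \<open>When \<open>p - a = e\<close>, strictness comes from the lower digits; for
        \<open>j = 0\<close> there are none, but then \<open>big\<close> would say
        \<open>p < p\<close>.\<close>
      have "K > 0"
      proof (cases j)
        case 0
        hence "K = 0" "P = 1" "b = 0" using b by (simp_all add: K_def P_def)
        thus ?thesis using big pa a by simp
      next
        case (Suc j')
        have "e * p ^ 0 \<le> K" unfolding K_def using Suc by (intro member_le_sum) auto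
        moreover have "e > 0" using pa a by simp
        ultimately show ?thesis by simp
      qed
      thus ?thesis using pa by (simp add: t_def)
    qed
    moreover have "p ^ Suc j \<le> R + t"
    proof -
      have "p ^ Suc j = P * (a + (p - a))" using a by (simp add: P_def)
      thus ?thesis unfolding R t_def distrib_left by simp
    qed
    moreover have "p - a \<le> a" using True assms(2) by linarith
    hence "\<not> p dvd R choose t"
      unfolding R t_def P_def using lucas_choose_dvd_iff[OF p, of b j 0 a "p - a"] b P0
        prime_not_dvd_choose_less[OF p a] p by (auto simp: P_def)
    ultimately show ?thesis unfolding goal by blast
  next
    case False
    have K: "K < P"
      unfolding K_def P_def using assms(2) by (intro repdigit_less) simp
    have "p - 1 - e \<le> a"
    proof (rule ccontr)
      assume "\<not> ?thesis"
      hence "a + e + 2 \<le> p" by linarith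
      hence "P * (a + e + 2) \<le> P * p" by (rule mult_le_mono2)
      thus False using big b K by (simp add: algebra_simps)
    qed
    hence a': "p = a + e + 1" using False by linarith
    hence "p * P = P * a + e * P + P" by (simp add: algebra_simps)
    hence "P < b + K" using big by linarith
    from Suc.IH[OF b[unfolded P_def] this[unfolded P_def K_def]] obtain t where t:
      "t < K" "P \<le> b + t" "\<not> p dvd b choose t" unfolding P_def K_def by blast
    have "\<not> p dvd (P * a + b) choose (P * e + t)"
      unfolding P_def using lucas_choose_dvd_iff[OF p, of b j t a e] b t K
        prime_not_dvd_choose_less[OF p a, of e] a' assms(2) by (auto simp: P_def)
    moreover have "P * e + t < K + e * P" using t by simp
    moreover have "p ^ Suc j \<le> R + (P * e + t)"
    proof -
      have "p ^ Suc j = P * a + P * e + P"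
        unfolding power_Suc P_def[symmetric] by (subst a') (simp add: algebra_simps)
      thus ?thesis using t(2) unfolding R by linarith
    qed
    ultimately show ?thesis unfolding goal R by blast
  qed
qed

subsection \<open>The auxiliary polynomial\<close>

lemma coeff_linear_factor_power:
  fixes a b :: "'a::comm_semiring_1"
  shows "coeff ([:b, a:] ^ n) i = of_nat (n choose i) * a ^ i * b ^ (n - i)"
proof (cases "i \<le> n")
  case True
  thus ?thesis by (rule coeff_linear_poly_power)
next
  case False
  have "degree ([:b, a:] ^ n) \<le> degree [:b, a:] * n" by (rule degree_power_le)
  also have "\<dots> \<le> n" by simp
  finally show ?thesis using False by (simp add: coeff_eq_0 binomial_eq_0)
qed

text \<open>Lagrange interpolation: the weight of \<open>a\<close> is the coefficient of
  \<open>x^w\<close> in the basis polynomial that is 1 at \<open>a\<close> and 0 on the rest of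
  \<open>A\<close>.\<close>

lemma coeff_functional_exists:
  fixes A :: "'a::field set"
  assumes "finite A"
  shows "\<exists>\<gamma>. \<forall>g. degree g < card A \<longrightarrow> (\<Sum>a\<in>A. \<gamma> a * poly g a) = coeff g w"
proof -
  define L where "L = (\<lambda>a. \<Prod>b\<in>A - {a}. smult (inverse (a - b)) [:- b, 1:])"
  have deg: "degree (L a) < card A" if "a \<in> A" for a
  proof -
    have "degree (L a) \<le> (\<Sum>b\<in>A - {a}. degree (smult (inverse (a - b)) [:- b, 1:]))"
      unfolding L_def using assms
      by (intro order_trans[OF degree_prod_sum_le]) (simp_all only: o_def finite_Diff order_refl)
    also have "\<dots> \<le> (\<Sum>b\<in>A - {a}. 1)"
      by (intro sum_mono) (simp add: degree_smult_le)
    also have "\<dots> < card A" using that assms by (simp only: sum_constant of_nat_id mult_1_right card_Diff1_less)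
    finally show ?thesis .
  qed
  have ev: "poly (L a) b = (if a = b then 1 else 0)" if "a \<in> A" "b \<in> A" for a b
  proof (cases "a = b")
    case True
    have "poly (smult (inverse (a - x)) [:- x, 1:]) a = 1" if "x \<in> A - {a}" for x
      using that by (auto simp: field_simps simp flip: diff_divide_distrib)
    thus ?thesis unfolding L_def poly_prod using True by (simp add: prod.neutral)
  next
    case False
    thus ?thesis using that assms by (auto simp: L_def poly_prod intro!: prod_zero)
  qed
  have "(\<Sum>a\<in>A. coeff (L a) w * poly g a) = coeff g w" if g: "degree g < card A" for g
  proof -
    have A: "A \<noteq> {}" using g by auto
    have "(\<Sum>a\<in>A. smult (poly g a) (L a)) = g"
    proof (rule poly_eqI_degree[of A])
      fix b assume b: "b \<in> A"
      have "poly (\<Sum>a\<in>A. smult (poly g a) (L a)) b = (\<Sum>a\<in>A. if a = b then poly g a else 0)"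
        unfolding poly_sum using b by (intro sum.cong) (auto simp: ev)
      thus "poly (\<Sum>a\<in>A. smult (poly g a) (L a)) b = poly g b" using b assms by simp
    next
      show "degree (\<Sum>a\<in>A. smult (poly g a) (L a)) < card A"
        using A g by (intro degree_sum_less) (auto intro: le_less_trans[OF degree_smult_le] deg)
    qed (rule g)
    hence "coeff g w = coeff (\<Sum>a\<in>A. smult (poly g a) (L a)) w" by simp
    thus ?thesis by (simp add: coeff_sum mult.commute)
  qed
  thus ?thesis by (intro exI[of _ "\<lambda>a. coeff (L a) w"]) simp
qed

text \<open>The exponent varies with the root because 0 will count with multiplicity
  \<open>V\<close> and the points of \<open>A\<close> with \<open>r\<close>.\<close>

lemma sum_multiplicities_le_degree:
  fixes f :: "'a::field poly"
  assumes "f \<noteq> 0" "finite B" "\<And>b. b \<in> B \<Longrightarrow> [:- b, 1:] ^ e b dvd f"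
  shows "(\<Sum>b\<in>B. e b) \<le> degree f"
proof -
  have "(\<Sum>b\<in>B. e b) \<le> (\<Sum>b\<in>B. order b f)"
    using assms by (intro sum_mono) (simp add: order_divides)
  also have "\<dots> = (\<Sum>b\<in>{b \<in> B. poly f b = 0}. order b f)"
    using assms by (intro sum.mono_neutral_right) (auto simp: order_root)
  also have "\<dots> \<le> (\<Sum>b | poly f b = 0. order b f)"
    using assms by (intro sum_mono2 poly_roots_finite) auto
  also have "\<dots> \<le> degree f" using assms(1) by (rule sum_order_le_degree)
  finally show ?thesis .
qed

text \<open>Hypotheses \<open>low\<close> and \<open>pow\<close> make the auxiliary polynomial vanish to order \<open>r\<close> on \<open>A\<close>.
  Hypotheses \<open>gap\<close> and \<open>gap'\<close> say that \<open>V\<close> is the first exponent above \<open>s\<close> that occurs in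
  \<open>(1 + x)\<^bsup>k + s\<^esup>\<close>, isolated up to \<open>V + t\<close>; they give divisibility by \<open>x\<^bsup>V\<^esup>\<close> and leave
  the coefficient of \<open>x\<^bsup>V + t\<^esup>\<close> as a single nonzero term.\<close>

lemma stepanov_bound:
  fixes A :: "'a::field set" and c :: 'a
  assumes fin: "finite A" and A0: "0 \<notin> A" and c: "c \<noteq> 0"
    and pow: "\<And>a b i. a \<in> A \<Longrightarrow> b \<in> A \<Longrightarrow> a \<noteq> b \<Longrightarrow> 0 < i \<Longrightarrow>
      (a * b + c) ^ (k + i) = (a * b + c) ^ i"
    and low: "\<And>u. u < r \<Longrightarrow> s \<le> u \<Longrightarrow> of_nat ((k + s) choose u) = (0 :: 'a)"
    and gap: "\<And>v. s < v \<Longrightarrow> v < V \<Longrightarrow> of_nat ((k + s) choose v) = (0 :: 'a)"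
    and gap': "\<And>v. V < v \<Longrightarrow> v \<le> V + t \<Longrightarrow> of_nat ((k + s) choose v) = (0 :: 'a)"
    and nz: "of_nat ((k + s) choose V) \<noteq> (0 :: 'a)" "of_nat (r choose t) \<noteq> (0 :: 'a)"
    and t: "s + t < V" and w: "r + V < card A + t"
  shows "V + r * card A \<le> r + k + s"
proof -
  define T where "T = k + s"
  have tr: "t \<le> r" using nz(2) by (metis binomial_eq_0 not_le of_nat_0)
  \<comment> \<open>The exponent \<open>r - t + V\<close> exceeds \<open>r + s\<close> by hypothesis
    \<open>t\<close> and is below \<open>card A\<close> by hypothesis \<open>w\<close>, so the
    weights annihilate degrees up to \<open>r + s\<close> but detect this power.\<close>
  obtain \<gamma> where \<gamma>: "\<And>g. degree g < card A \<Longrightarrow>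
      (\<Sum>a\<in>A. \<gamma> a * poly g a) = coeff g (r - t + V)"
    using coeff_functional_exists[OF fin, of "r - t + V"] by blast
  define M where "M = (\<lambda>i. \<Sum>a\<in>A. \<gamma> a * a ^ i)"
  have M: "M i = (if i = r - t + V then 1 else 0)" if "i < card A" for i
    using \<gamma>[of "monom 1 i"] that by (simp add: M_def degree_monom_eq poly_monom)
  have M0: "M i = 0" if "i \<le> r + s" for i
    using M[of i] that t w tr by simp
  have M1: "M (r - t + V) = 1" using M[of "r - t + V"] w tr by simp
  \<comment> \<open>\<open>Q\<close> is a polynomial in \<open>a\<close> whose coefficients are
    polynomials in \<open>x\<close>.\<close>
  have kill: "(\<Sum>a\<in>A. [:\<gamma> a:] * poly Q [:a:]) = 0" if "degree Q \<le> r + s" for Q :: "'a poly poly"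
  proof -
    have "(\<Sum>a\<in>A. [:\<gamma> a:] * poly Q [:a:]) =
        (\<Sum>a\<in>A. \<Sum>i\<le>degree Q. coeff Q i * [:\<gamma> a * a ^ i:])"
      unfolding poly_altdef sum_distrib_left
      by (intro sum.cong refl) (simp add: poly_const_pow mult_ac)
    also have "\<dots> = (\<Sum>i\<le>degree Q. \<Sum>a\<in>A. coeff Q i * [:\<gamma> a * a ^ i:])"
      by (rule sum.swap)
    also have "\<dots> = (\<Sum>i\<le>degree Q. coeff Q i * (\<Sum>a\<in>A. [:\<gamma> a * a ^ i:]))"
      by (simp add: sum_distrib_left)
    also have "\<dots> = (\<Sum>i\<le>degree Q. coeff Q i * [:M i:])"
    proof -
      have "(\<Sum>a\<in>A. [:\<gamma> a * a ^ i:]) = [:M i:]" for i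
        by (simp add: M_def coeff_sum poly_eq_iff coeff_pCons split: nat.splits)
      thus ?thesis by (simp only:)
    qed
    also have "\<dots> = 0" using that by (intro sum.neutral) (simp add: M0)
    finally show ?thesis .
  qed

  define f where "f = (\<Sum>a\<in>A. [:\<gamma> a:] * ([:- a, 1:] ^ r * [:c, a:] ^ T))"

  have coeff_f: "coeff f l = (\<Sum>i\<le>l. of_nat (r choose i) * of_nat (T choose (l - i)) *
      (-1) ^ (r - i) * c ^ (T - (l - i)) * M (r - i + (l - i)))" for l
  proof -
    have "coeff f l = (\<Sum>a\<in>A. \<Sum>i\<le>l. of_nat (r choose i) * of_nat (T choose (l - i)) *
      (-1) ^ (r - i) * c ^ (T - (l - i)) * (\<gamma> a * a ^ (r - i + (l - i))))"
      unfolding f_def coeff_sum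
    proof (intro sum.cong refl)
      fix a
      have "coeff ([:\<gamma> a:] * ([:- a, 1:] ^ r * [:c, a:] ^ T)) l =
        \<gamma> a * (\<Sum>i\<le>l. coeff ([:- a, 1:] ^ r) i * coeff ([:c, a:] ^ T) (l - i))"
        by (simp add: coeff_mult)
      also have "\<dots> = (\<Sum>i\<le>l. of_nat (r choose i) * of_nat (T choose (l - i)) *
        (-1) ^ (r - i) * c ^ (T - (l - i)) * (\<gamma> a * a ^ (r - i + (l - i))))"
        unfolding sum_distrib_left power_add coeff_linear_factor_power power_minus[of a]
        by (intro sum.cong refl) (simp add: mult_ac)
      finally show "coeff ([:\<gamma> a:] * ([:- a, 1:] ^ r * [:c, a:] ^ T)) l = \<dots>" .
    qed
    also have "\<dots> = (\<Sum>i\<le>l. \<Sum>a\<in>A. of_nat (r choose i) * of_nat (T choose (l - i)) *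
      (-1) ^ (r - i) * c ^ (T - (l - i)) * (\<gamma> a * a ^ (r - i + (l - i))))"
      by (rule sum.swap)
    finally show ?thesis by (simp add: M_def sum_distrib_left)
  qed
  have vanish: "of_nat (r choose i) * of_nat (T choose v) * x * y * M (r - i + v) = 0"
    if "v < V" for i v x y
  proof (cases "v \<le> s")
    case True
    thus ?thesis using M0[of "r - i + v"] by simp
  next
    case False
    thus ?thesis using gap[of v] that by (simp add: T_def)
  qed
  have low_coeff: "coeff f l = 0" if "l < V" for l
    unfolding coeff_f by (intro sum.neutral ballI vanish) (use that in auto)
  \<comment> \<open>Terms with \<open>i < t\<close> vanish by \<open>gap'\<close>, those with
    \<open>i > t\<close> by \<open>vanish\<close>; the term \<open>i = t\<close> carries the moment
    \<open>M (r - t + V) = 1\<close>.\<close>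
  have "coeff f (V + t) = (\<Sum>i\<in>{t}. of_nat (r choose i) * of_nat (T choose (V + t - i)) *
      (-1) ^ (r - i) * c ^ (T - (V + t - i)) * M (r - i + (V + t - i)))"
    unfolding coeff_f
  proof (intro sum.mono_neutral_right ballI)
    fix i assume i: "i \<in> {..V + t} - {t}"
    show "of_nat (r choose i) * of_nat (T choose (V + t - i)) *
      (-1) ^ (r - i) * c ^ (T - (V + t - i)) * M (r - i + (V + t - i)) = 0"
    proof (cases "i < t")
      case True
      thus ?thesis using gap'[of "V + t - i"] by (simp add: T_def)
    next
      case False
      thus ?thesis using i by (intro vanish) auto
    qed
  qed auto
  also have "\<dots> \<noteq> 0" using nz c M1 by (simp add: T_def)
  finally have f0: "f \<noteq> 0" by auto

  have mult_A: "[:- b, 1:] ^ r dvd f" if b: "b \<in> A" for b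
  proof -
    \<comment> \<open>Truncated Taylor expansion of \<open>(a * x + c) ^ T\<close> at
      \<open>b\<close>, with \<open>(a * b + c) ^ (T - u)\<close> lowered to exponent
      \<open>s - u\<close> so that the degree in \<open>a\<close> is at most \<open>r + s\<close>.
      Cutting at \<open>min r s\<close> keeps \<open>s - u > 0\<close>, as \<open>pow\<close>
      requires; orders from \<open>s\<close> up to \<open>r - 1\<close> vanish by
      \<open>low\<close>.\<close>
    define Q :: "'a poly poly" where "Q = [:[:0, 1:], -1:] ^ r *
      (\<Sum>u<min r s. smult ([:of_nat (T choose u):] * [:- b, 1:] ^ u)
        (monom 1 u * [:[:c:], [:b:]:] ^ (s - u)))"
    have "degree Q \<le> r + s"
    proof -
      have "degree (smult ([:of_nat (T choose u):] * [:- b, 1:] ^ u)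
        (monom 1 u * [:[:c:], [:b:]:] ^ (s - u))) \<le> s" if "u \<in> {..<min r s}" for u
      proof -
        have "degree ([:[:c:], [:b:]:] ^ (s - u)) \<le> degree [:[:c:], [:b:]:] * (s - u)"
          by (rule degree_power_le)
        also have "\<dots> \<le> s - u" by simp
        finally have "degree (monom 1 u * [:[:c:], [:b:]:] ^ (s - u)) \<le> u + (s - u)"
          by (intro order_trans[OF degree_mult_le] add_mono) (simp_all add: degree_monom_le)
        thus ?thesis using that by (intro order_trans[OF degree_smult_le]) auto
      qed
      moreover have "degree ([:[:0, 1:], -1:] ^ r :: 'a poly poly) \<le> r"
        using degree_power_le[of "[:[:0, 1:], -1:] :: 'a poly poly" r] by simp
      ultimately show ?thesis unfolding Q_def
        by (intro order_trans[OF degree_mult_le] add_mono degree_sum_le) auto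
    qed
    hence Q0: "(\<Sum>a\<in>A. [:\<gamma> a:] * poly Q [:a:]) = 0" by (rule kill)
    have polyQ: "poly Q [:a:] = [:- a, 1:] ^ r * (\<Sum>u<min r s.
      [:of_nat (T choose u) * a ^ u * (a * b + c) ^ (s - u):] * [:- b, 1:] ^ u)" for a
    proof -
      have "poly (smult ([:of_nat (T choose u):] * [:- b, 1:] ^ u)
        (monom 1 u * [:[:c:], [:b:]:] ^ (s - u))) [:a:] =
        [:of_nat (T choose u) * a ^ u * (a * b + c) ^ (s - u):] * [:- b, 1:] ^ u" for u
        by (simp add: poly_monom poly_const_pow mult_ac add_ac)
      thus ?thesis unfolding Q_def by (simp add: poly_sum)
    qed
    have term_dvd: "[:- b, 1:] ^ r dvd [:- a, 1:] ^ r * [:c, a:] ^ T - poly Q [:a:]"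
      if a: "a \<in> A" for a
    proof (cases "a = b")
      case True
      show ?thesis unfolding polyQ True by (intro dvd_diff dvd_triv_left)
    next
      case False
      define z where "z = a * b + c"
      have "[:c, a:] = smult a [:- b, 1:] + [:z:]" by (simp add: z_def)
      hence "[:c, a:] ^ T =
          (\<Sum>u\<le>T. of_nat (T choose u) * (smult a [:- b, 1:]) ^ u * [:z:] ^ (T - u))"
        by (simp only: binomial_ring)
      also have "\<dots> = (\<Sum>u\<le>T. [:of_nat (T choose u) * a ^ u * z ^ (T - u):] * [:- b, 1:] ^ u)"
      proof (intro sum.cong refl)
        have "of_nat N * (smult a X) ^ u * [:z:] ^ i = [:of_nat N * a ^ u * z ^ i:] * X ^ u"
          for N u i and X :: "'a poly"
          by (simp add: smult_power poly_const_pow of_nat_poly mult_ac)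
        thus "of_nat (T choose u) * (smult a [:- b, 1:]) ^ u * [:z:] ^ (T - u) =
          [:of_nat (T choose u) * a ^ u * z ^ (T - u):] * [:- b, 1:] ^ u" for u .
      qed
      finally have exp: "[:c, a:] ^ T = \<dots>" .
      have "[:- b, 1:] ^ r dvd
        [:c, a:] ^ T - (\<Sum>u<min r s. [:of_nat (T choose u) * a ^ u * z ^ (s - u):] * [:- b, 1:] ^ u)"
      proof -
        have eq: "(\<Sum>u<min r s. [:of_nat (T choose u) * a ^ u * z ^ (s - u):] * [:- b, 1:] ^ u) =
          (\<Sum>u<min r s. [:of_nat (T choose u) * a ^ u * z ^ (T - u):] * [:- b, 1:] ^ u)"
        proof (intro sum.cong refl)
          fix u assume "u \<in> {..<min r s}"
          hence "z ^ (s - u) = z ^ (T - u)"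
            using pow[OF a b False, of "s - u"] by (simp add: z_def T_def)
          thus "[:of_nat (T choose u) * a ^ u * z ^ (s - u):] * [:- b, 1:] ^ u =
            [:of_nat (T choose u) * a ^ u * z ^ (T - u):] * [:- b, 1:] ^ u" by simp
        qed
        have split: "[:c, a:] ^ T =
          (\<Sum>u<min r s. [:of_nat (T choose u) * a ^ u * z ^ (T - u):] * [:- b, 1:] ^ u) +
          (\<Sum>u\<in>{min r s..T}. [:of_nat (T choose u) * a ^ u * z ^ (T - u):] * [:- b, 1:] ^ u)"
        proof -
          have "{..T} = {..<min r s} \<union> {min r s..T}" by (auto simp: T_def)
          thus ?thesis unfolding exp by (simp only:) (intro sum.union_disjoint; auto)
        qed
        have "[:- b, 1:] ^ r dvd
          (\<Sum>u\<in>{min r s..T}. [:of_nat (T choose u) * a ^ u * z ^ (T - u):] * [:- b, 1:] ^ u)"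
        proof (intro dvd_sum)
          fix u assume u: "u \<in> {min r s..T}"
          show "[:- b, 1:] ^ r dvd
            [:of_nat (T choose u) * a ^ u * z ^ (T - u):] * [:- b, 1:] ^ u"
          proof (cases "r \<le> u")
            case True
            thus ?thesis by (intro dvd_mult le_imp_power_dvd)
          next
            case False
            hence "of_nat (T choose u) = (0 :: 'a)" unfolding T_def using u by (intro low) auto
            thus ?thesis by simp
          qed
        qed
        thus ?thesis unfolding eq split add_diff_cancel_left' .
      qed
      hence "[:- b, 1:] ^ r dvd [:- a, 1:] ^ r * ([:c, a:] ^ T -
        (\<Sum>u<min r s. [:of_nat (T choose u) * a ^ u * z ^ (s - u):] * [:- b, 1:] ^ u))"
        by (rule dvd_mult)
      thus ?thesis unfolding polyQ right_diff_distrib z_def .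
    qed
    \<comment> \<open>By \<open>Q0\<close>, subtracting \<open>Q\<close> does not change
      \<open>f\<close>, yet it makes every summand divisible.\<close>
    have "f = (\<Sum>a\<in>A. [:\<gamma> a:] * ([:- a, 1:] ^ r * [:c, a:] ^ T - poly Q [:a:]))"
      unfolding right_diff_distrib sum_subtractf Q0 f_def by simp
    also have "[:- b, 1:] ^ r dvd \<dots>"
      by (intro dvd_sum dvd_mult term_dvd)
    finally show ?thesis .
  qed

  have "[:- 0, 1:] ^ V dvd f"
  proof -
    have "monom 1 V dvd f" using low_coeff by (subst monom_1_dvd_iff') auto
    thus ?thesis by (simp add: monom_altdef)
  qed
  hence "(\<Sum>b\<in>insert 0 A. if b = 0 then V else r) \<le> degree f"
    using mult_A A0 fin by (intro sum_multiplicities_le_degree f0) auto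
  moreover have "(\<Sum>b\<in>A. if b = 0 then V else r) = (\<Sum>b\<in>A. r)"
    using A0 by (intro sum.cong) auto
  moreover have "degree f \<le> r + T"
  proof -
    have "degree ([:\<gamma> a:] * ([:- a, 1:] ^ r * [:c, a:] ^ T)) \<le> r + T" for a
    proof -
      have "degree ([:- a, 1:] ^ r) \<le> r" "degree ([:c, a:] ^ T) \<le> T"
        using degree_power_le[of "[:- a, 1:]" r] degree_power_le[of "[:c, a:]" T]
        by (auto split: if_splits)
      hence "degree ([:- a, 1:] ^ r * [:c, a:] ^ T) \<le> r + T"
        by (intro order_trans[OF degree_mult_le] add_mono)
      thus ?thesis using order_trans[OF degree_smult_le[of "\<gamma> a"]] by simp
    qed
    thus ?thesis unfolding f_def using fin by (intro degree_sum_le) auto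
  qed
  ultimately show ?thesis using A0 fin by (simp add: T_def mult.commute)
qed

subsection \<open>Diophantine tuples\<close>

text \<open>The factor \<open>card A div 2 - 2\<close> is the vanishing order \<open>R - 1\<close>
  reached without a carry; the carry case reaches \<open>R\<close>.\<close>

lemma diophantine_tuple_bound:
  fixes c :: "'a::{field,finite}" and A :: "'a set"
  assumes d: "d \<ge> 2" and p: "prime p" and dp: "d dvd p - 1" and n: "n \<ge> 1"
    and q: "CARD('a) = p ^ n" and c: "c \<noteq> 0"
    and A: "0 \<notin> A" "has_property_D d c A"
  shows "\<exists>k. p ^ n - 1 = d * k \<and> (card A div 2 - 2) * (card A - 1) < k"
proof -
  define e where "e = (p - 1) div d"
  define k where "k = (\<Sum>i<n. e * p ^ i)"
  define m R where "m = card A" and "R = m div 2 - 1"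
  have p1: "p > 1" using p by (rule prime_gt_1_nat)
  have de: "p - 1 = d * e" using dp by (simp add: e_def)
  have e0: "e > 0" using de p1 by (cases e) auto
  have e2: "2 * e < p"
  proof -
    have "2 * e \<le> d * e" using d by simp
    thus ?thesis using de p1 by linarith
  qed
  have dk: "d * k = p ^ n - 1"
  proof -
    have "p = d * e + 1" using de p1 by simp
    hence "d * (\<Sum>i<l. e * p ^ i) + 1 = p ^ l" for l
      by (induction l) (simp_all add: algebra_simps)
    from this[of n] show ?thesis by (simp add: k_def)
  qed
  have k_mod: "k mod p ^ j = (\<Sum>i<j. e * p ^ i)" if "j \<le> n" for j
  proof -
    have "k = (\<Sum>i<j. e * p ^ i) + (\<Sum>i\<in>{j..<n}. e * p ^ i)"
      unfolding k_def using that
      by (simp add: sum.atLeastLessThan_concat flip: atLeast0LessThan)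
    moreover have "p ^ j dvd (\<Sum>i\<in>{j..<n}. e * p ^ i)"
      by (intro dvd_sum dvd_mult le_imp_power_dvd) simp
    moreover have "(\<Sum>i<j. e * p ^ i) < p ^ j" using e2 by (intro repdigit_less) simp
    ultimately show ?thesis by (auto elim!: dvdE)
  qed
  have k0: "k > 0" using k_mod[of 1] n e0 by (cases k) auto

  have char: "CHAR('a) = p"
  proof -
    have "prime CHAR('a)"
      by (intro prime_CHAR_semidom finite_imp_CHAR_pos) simp
    moreover have "CHAR('a) dvd p ^ n" using CHAR_dvd_CARD[where 'a = 'a] q by simp
    ultimately show ?thesis using p prime_dvd_power primes_dvd_imp_eq by blast
  qed
  have of_nat0: "of_nat x = (0 :: 'a) \<longleftrightarrow> p dvd x" for x
    by (simp add: of_nat_eq_0_iff_char_dvd char)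

  \<comment> \<open>A nonzero value is a \<open>d\<close>-th power, so its \<open>k\<close>-th power
    is 1; \<open>0 < i\<close> covers the value 0.\<close>
  have pow: "(a * b + c) ^ (k + i) = (a * b + c) ^ i"
    if "a \<in> A" "b \<in> A" "a \<noteq> b" "0 < i" for a b i
  proof (cases "a * b + c = 0")
    case True
    thus ?thesis using that k0 by (simp add: power_0_left)
  next
    case False
    have "a * b + c \<in> nonzero_powers d \<union> {0}"
      using A(2) that unfolding has_property_D_def by simp
    with False obtain x where x: "a * b + c = x ^ d" "x \<noteq> 0"
      unfolding nonzero_powers_def by auto
    have "(\<Prod>y\<in>UNIV - {0}. x * y) = (\<Prod>y\<in>UNIV - {0}. y)"
      by (rule prod.reindex_bij_witness[of _ "\<lambda>y. y / x" "\<lambda>y. x * y"]) (use x in auto)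
    hence "x ^ (CARD('a) - 1) * \<Prod>(UNIV - {0}) = \<Prod>(UNIV - {0 :: 'a})"
      by (simp add: prod.distrib)
    hence "x ^ (p ^ n - 1) = 1" by (simp add: q)
    hence "x ^ (d * k) = 1" by (simp add: dk)
    thus ?thesis by (simp add: x(1) power_add flip: power_mult)
  qed
  note stepanov = stepanov_bound[OF finite A(1) c, unfolded of_nat0, folded m_def]

  have "(m div 2 - 2) * (m - 1) < k"
  proof (cases "m div 2 \<le> 2")
    case True
    thus ?thesis using k0 by simp
  next
    case False
    have R2: "R \<ge> 2" "2 * R + 2 \<le> m" using False by (auto simp: R_def)
    have "(R - 1) * (m - 1) < k"
    proof (cases "p dvd (R + (k - 1)) choose R")
      case False
      \<comment> \<open>With \<open>r = s = R - 1\<close>, \<open>V = R\<close> and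
        \<open>t = 0\<close>, the hypotheses \<open>low\<close>, \<open>gap\<close> and
        \<open>gap'\<close> are vacuous.\<close>
      have "R + (R - 1) * m \<le> (R - 1) + k + (R - 1)"
      proof (rule stepanov[where t = 0])
        have "k + (R - 1) = R + (k - 1)" using R2 k0 by simp
        thus "\<not> p dvd (k + (R - 1)) choose R" using False by simp
      qed (use pow R2 p1 in auto)
      thus ?thesis unfolding diff_mult_distrib2 mult_1_right using R2 k0 by linarith
    next
      case True
      from topmost_carry[OF p True] obtain j where j: "j \<ge> 1"
        "p ^ j \<le> R mod p ^ j + (k - 1) mod p ^ j"
        "\<not> p dvd (R div p ^ j + 1 + (k - 1) div p ^ j) choose (R div p ^ j + 1)" by blast
      define P a b h \<kappa> where "P = p ^ j" and "a = R div P" and "b = R mod P"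
        and "h = k div P" and "\<kappa> = k mod P"
      have P: "P > 0" "p ^ 1 dvd P" using p1 j(1) unfolding P_def by (auto intro: le_imp_power_dvd)
      have Rk: "R = P * a + b" "k = P * h + \<kappa>" "b < P" "\<kappa> < P"
        using P by (simp_all add: a_def b_def h_def \<kappa>_def)
      \<comment> \<open>Both \<open>m\<close> and \<open>2 * k\<close> are below
        \<open>p ^ n\<close>, hence so is \<open>R + k\<close>, while the carry gives
        \<open>P \<le> R + (k - 1)\<close>. So \<open>j < n\<close>, and the last \<open>j\<close>
        digits of \<open>k\<close> all equal \<open>e\<close>.\<close>
      have "m < p ^ n"
      proof -
        have "card A < CARD('a)" using A(1) by (intro psubset_card_mono) auto
        thus ?thesis by (simp add: m_def q)
      qed
      moreover have "2 * k \<le> p ^ n - 1" using d dk by (metis mult_le_mono1)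
      ultimately have "R + k < p ^ n" using R2 by linarith
      moreover have "P \<le> R + (k - 1)"
        using j(2) by (metis P_def add_mono mod_less_eq_dividend order_trans)
      ultimately have "p ^ j < p ^ n" using k0 unfolding P_def by linarith
      hence jn: "j < n" using p1 by (simp add: power_strict_increasing_iff)
      \<comment> \<open>The last digit of \<open>k\<close> is nonzero, so \<open>k - 1\<close> and
        \<open>k\<close> agree from position \<open>j\<close> on.\<close>
      have "\<kappa> \<noteq> 0"
      proof
        assume "\<kappa> = 0"
        hence "p dvd k" using P by (metis \<kappa>_def dvd_trans mod_0_imp_dvd power_one_right)
        thus False using k_mod[of 1] n e0 e2 by simp
      qed
      hence "k - 1 = P * h + (\<kappa> - 1)" "\<kappa> - 1 < P" using Rk(2,4) by simp_all
      hence "(k - 1) mod P = \<kappa> - 1" "(k - 1) div P = h" using P(1) by simp_all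
      hence carry: "P < b + \<kappa>" and hi: "\<not> p dvd (a + 1 + h) choose (a + 1)"
        using j \<open>\<kappa> \<noteq> 0\<close> by (simp_all add: a_def b_def flip: P_def)
      have \<kappa>: "\<kappa> = (\<Sum>i<j. e * p ^ i)" using k_mod[of j] jn by (simp add: \<kappa>_def P_def)
      obtain t where t: "t < \<kappa>" "P \<le> b + t" "\<not> p dvd b choose t"
        using repdigit_complement_choose[OF p e2, of b j] Rk(3) carry unfolding \<kappa> P_def by blast
      \<comment> \<open>\<open>V\<close> is the first multiple of \<open>P\<close> above
        \<open>R\<close>, and \<open>s\<close> cancels the low part of \<open>k\<close> in
        \<open>k + s\<close>.\<close>
      define V s where "V = P * (a + 1)" and "s = V - \<kappa>"
      have s: "k + s = P * (a + 1 + h)" "P * a < s" "s + \<kappa> = V"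
        using Rk(2,4) by (simp_all add: V_def s_def algebra_simps)
      have multiple: "p dvd (k + s) choose u" if "\<not> P dvd u" for u
      proof -
        have "0 < u mod P" "u mod P < P" using that P by (auto simp: dvd_eq_mod_eq_0)
        hence "p dvd (P * (a + 1 + h) + 0) choose (P * (u div P) + u mod P)"
          using p1 unfolding P_def
          by (subst lucas_choose_dvd_iff[OF p]) (auto simp: binomial_eq_0)
        thus ?thesis by (simp add: s)
      qed
      have between: "\<not> P dvd u" if "P * x < u" "u < P * (x + 1)" for u x
      proof
        assume "P dvd u"
        then obtain y where "u = P * y" ..
        hence "x < y" "y < x + 1" using that by (simp_all only: mult_less_cancel1)
        thus False by simp
      qed
      have "V + R * m \<le> R + k + s"
      proof (rule stepanov[where t = t])
        fix u assume "u < R" "s \<le> u"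
        thus "p dvd (k + s) choose u"
          using Rk(1,3) s(2) by (intro multiple between[of a]) auto
      next
        fix u assume "s < u" "u < V"
        thus "p dvd (k + s) choose u"
          using s(2) by (intro multiple between[of a]) (auto simp: V_def)
      next
        fix u assume "V < u" "u \<le> V + t"
        thus "p dvd (k + s) choose u"
          using t(1) Rk(4) by (intro multiple between[of "a + 1"]) (auto simp: V_def)
      next
        show "\<not> p dvd (k + s) choose V"
          using hi lucas_choose_dvd_iff[OF p, of 0 j 0 "a + 1 + h" "a + 1"] P p1
          by (simp add: s V_def P_def)
        have "\<not> p dvd (P * a + b) choose (P * 0 + t)"
          using t Rk(3,4) p1 unfolding P_def by (subst lucas_choose_dvd_iff[OF p]) auto
        thus "\<not> p dvd R choose t" by (simp add: Rk(1))
        show "s + t < V" using s(3) t(1) by simp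
        \<comment> \<open>Here \<open>P \<le> b + t\<close> is decisive: it gives
          \<open>V \<le> R + t\<close>, so the left side is at most
          \<open>2 * R + t\<close>.\<close>
        show "R + V < m + t" using R2 t(2) Rk(1) by (simp add: V_def)
      qed (rule pow)
      hence "R * m < R + k" using s(3) \<open>\<kappa> \<noteq> 0\<close> by linarith
      hence "R * (m - 1) < k" unfolding diff_mult_distrib2 mult_1_right using k0 by linarith
      thus ?thesis by (meson diff_le_self le_less_trans mult_le_mono1)
    qed
    moreover have "R - 1 = m div 2 - 2" by (simp add: R_def)
    ultimately show ?thesis by simp
  qed
  thus ?thesis using dk[symmetric] unfolding m_def by blast
qed

theorem theorem4p7:
  fixes d p q n :: nat and c :: "'a::{field,finite}"
  assumes "d \<ge> 2"
    and "prime p"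
    and "d dvd p - 1"
    and "n \<ge> 1"
    and "q = p ^ n"
    and "CARD('a) = q"
    and "c \<noteq> 0"
  shows "real (MD d c) \<le> sqrt (2 * (real q - 1) / real d) + 4"
proof -
  let ?S = "{card A | A. A \<subseteq> UNIV - {0} \<and> has_property_D d c A}"
  have "?S = card ` {A. A \<subseteq> UNIV - {0} \<and> has_property_D d c A}" by auto
  hence "finite ?S" by simp
  moreover have "card {} \<in> ?S" by (force simp: has_property_D_def)
  ultimately have "MD d c \<in> ?S" unfolding MD_def by (intro Max_in) auto
  then obtain A where A: "A \<subseteq> UNIV - {0}" "has_property_D d c A" "MD d c = card A" by blast
  define m where "m = card A"
  obtain k where "q - 1 = d * k" and bound: "(m div 2 - 2) * (m - 1) < k"
    using diophantine_tuple_bound[of d p n c A] assms A by (auto simp: m_def)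
  moreover have "q \<ge> 1" using assms(2,5) by (simp add: prime_gt_0_nat Suc_leI)
  ultimately have "real q - 1 = real d * real k"
    by (metis of_nat_1 of_nat_diff of_nat_mult)
  hence rhs: "2 * (real q - 1) / real d = 2 * real k" using assms(1) by simp
  have "real m - 4 \<le> sqrt (2 * real k)"
  proof (cases "m \<le> 4")
    case True
    hence "real m - 4 \<le> 0" by simp
    also have "0 \<le> sqrt (2 * real k)" by simp
    finally show ?thesis .
  next
    case False
    have "m \<le> 2 * (m div 2 - 2) + 5" by linarith
    hence "(real m - 5) * (real m - 1) \<le> 2 * real (m div 2 - 2) * real (m - 1)"
      using False by (intro mult_mono) auto
    also have "\<dots> = 2 * real ((m div 2 - 2) * (m - 1))" by simp
    also have "\<dots> \<le> 2 * (real k - 1)" using bound by (simp del: of_nat_mult)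
    \<comment> \<open>\<open>(m - 4)^2\<close> equals \<open>(m - 5) * (m - 1) + 11 - 2 * m\<close>;
      for \<open>m \<ge> 5\<close> the correction is at most 1, within the slack 2 left by the
      strict bound.\<close>
    finally have "(real m - 4)\<^sup>2 \<le> 2 * real k"
      using False by (simp add: power2_eq_square algebra_simps)
    thus ?thesis by (rule real_le_rsqrt)
  qed
  thus ?thesis unfolding rhs A(3) m_def by simp
qed

end
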